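(* Let $\mathcal{H}$ be an infinite dimensional quaternionic Hilbert space and let $T\in\mathcal{B}(\mathcal{H})$. Then the closure of the numerical range of $T$ is $$\overline{W(T)}=\mathrm{iconv}\{W_e(T),W(T)\}.$$
   Context: $\mathbb{H}$ denotes the real quaternions. $\mathcal{H}$ is an infinite dimensional two-sided Hilbert space over $\mathbb{H}$ with $\mathbb{H}$-valued inner product $\langle\cdot,\cdot\rangle$ (so $\langle x p, y q\rangle = q^*\langle x,y\rangle p$ and $\langle y,x\rangle=\langle x,y\rangle^*$ for $p,q\in\mathbb{H}$, where $q^*$ is the quaternionic conjugate) and norm $\|x\|=\sqrt{\langle x,x\rangle}$. $\mathcal{B}(\mathcal{H})$ is the space of bounded right $\mathbb{H}$-linear operators on $\mathcal{H}$ and $\mathcal{K}(\mathcal{H})$ is its closed ideal of compact operators. The (quaternionic) numerical range of $T$ is $W(T)=\{\langle Tx,x\rangle : x\in\mathcal{H},\ \|x\|=1\}\subseteq\mathbb{H}$, and the (quaternionic) essential numerical range is $W_e(T)=\bigcap_{K\in\mathcal{K}(\mathcal{H})}\overline{W(T+K)}$, where the bar denotes closure in $\mathbb{H}$. For sets $A,B\subseteq\mathbb{H}$, the inter-convex hull is $\mathrm{iconv}\{A,B\}=\{\alpha a+(1-\alpha)b : a\in A,\ b\in B,\ \alpha\in\mathbb{R},\ 0\le\alpha\le1\}$. *)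

theory Defs
  imports "HOL-Analysis.Analysis"
begin

section \<open>The real quaternions\<close>

datatype quat = Quat (qRe: real) (qI: real) (qJ: real) (qK: real)

lemma quat_eq_iff: "p = q \<longleftrightarrow> qRe p = qRe q \<and> qI p = qI q \<and> qJ p = qJ q \<and> qK p = qK q"
  by (cases p; cases q) simp

definition qcnj :: "quat \<Rightarrow> quat" where
  "qcnj q = Quat (qRe q) (- qI q) (- qJ q) (- qK q)"

instantiation quat :: ring_1
begin

definition "0 = Quat 0 0 0 0"
definition "1 = Quat 1 0 0 0"
definition "p + q = Quat (qRe p + qRe q) (qI p + qI q) (qJ p + qJ q) (qK p + qK q)"
definition "p - q = Quat (qRe p - qRe q) (qI p - qI q) (qJ p - qJ q) (qK p - qK q)"
definition "- q = Quat (- qRe q) (- qI q) (- qJ q) (- qK q)"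
definition "p * q = Quat
    (qRe p * qRe q - qI p * qI q - qJ p * qJ q - qK p * qK q)
    (qRe p * qI q + qI p * qRe q + qJ p * qK q - qK p * qJ q)
    (qRe p * qJ q - qI p * qK q + qJ p * qRe q + qK p * qI q)
    (qRe p * qK q + qI p * qJ q - qJ p * qI q + qK p * qRe q)"

instance
  by standard
    (auto simp: quat_eq_iff zero_quat_def one_quat_def plus_quat_def minus_quat_def
      uminus_quat_def times_quat_def algebra_simps)

end

lemma quat_sel [simp]:
  "qRe 0 = 0" "qI 0 = 0" "qJ 0 = 0" "qK 0 = 0"
  "qRe 1 = 1" "qI 1 = 0" "qJ 1 = 0" "qK 1 = 0"
  "qRe (p + q) = qRe p + qRe q" "qI (p + q) = qI p + qI q"
  "qJ (p + q) = qJ p + qJ q" "qK (p + q) = qK p + qK q"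
  "qRe (p - q) = qRe p - qRe q" "qI (p - q) = qI p - qI q"
  "qJ (p - q) = qJ p - qJ q" "qK (p - q) = qK p - qK q"
  "qRe (- q) = - qRe q" "qI (- q) = - qI q" "qJ (- q) = - qJ q" "qK (- q) = - qK q"
  "qRe (qcnj q) = qRe q" "qI (qcnj q) = - qI q" "qJ (qcnj q) = - qJ q" "qK (qcnj q) = - qK q"
  by (simp_all add: zero_quat_def one_quat_def plus_quat_def minus_quat_def uminus_quat_def
      qcnj_def)

instantiation quat :: real_vector
begin

definition "scaleR r q = Quat (r * qRe q) (r * qI q) (r * qJ q) (r * qK q)"

instance
  by standard (simp_all add: quat_eq_iff scaleR_quat_def algebra_simps)

end

instantiation quat :: real_inner
begin

definition "inner p q = qRe p * qRe q + qI p * qI q + qJ p * qJ q + qK p * qK q" for p q :: quat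
definition "norm q = sqrt (inner q q)" for q :: quat
definition "dist p q = norm (p - q)" for p q :: quat
definition "sgn q = q /\<^sub>R norm q" for q :: quat
definition "(uniformity :: (quat \<times> quat) filter) = (INF e\<in>{0<..}. principal {(x, y). dist x y < e})"
definition "open U \<longleftrightarrow> (\<forall>x\<in>U. eventually (\<lambda>(x', y). x' = x \<longrightarrow> y \<in> U) uniformity)" for U :: "quat set"

instance
proof
  fix x :: quat
  show "0 \<le> inner x x" by (simp add: inner_quat_def)
  show "(inner x x = 0) = (x = 0)"
    by (simp add: inner_quat_def quat_eq_iff add_nonneg_eq_0_iff)
qed (simp_all add: quat_eq_iff scaleR_quat_def inner_quat_def norm_quat_def dist_quat_def
      sgn_quat_def uniformity_quat_def open_quat_def algebra_simps)

end

instance quat :: real_normed_algebra_1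
proof
  fix p q :: quat and r :: real
  show "r *\<^sub>R p * q = r *\<^sub>R (p * q)" "p * r *\<^sub>R q = r *\<^sub>R (p * q)"
    by (simp_all add: quat_eq_iff scaleR_quat_def times_quat_def algebra_simps)
  have "inner (p * q) (p * q) = inner p p * inner q q"
    by (simp add: inner_quat_def times_quat_def algebra_simps)
  then show "norm (p * q) \<le> norm p * norm q"
    by (simp add: norm_quat_def real_sqrt_mult)
  show "norm (1 :: quat) = 1"
    by (simp add: norm_quat_def inner_quat_def)
qed


section \<open>Two-sided quaternionic Hilbert spaces\<close>

text \<open>
  The real normed space structure is the one induced by the quaternionic structure: real scaling is
  the action of the real quaternions, on either side, and the norm is the one of the quaternionic
  inner product; completeness comes from \<^class>\<open>banach\<close>.  The inner product is right linear in its
  first argument.  Of the left action only the bimodule laws are required; no compatibility with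
  the inner product is assumed.
\<close>

class quat_hilbert = banach +
  fixes rscale :: "'a \<Rightarrow> quat \<Rightarrow> 'a" (infixl "*\<^sub>H" 75)
    and lscale :: "quat \<Rightarrow> 'a \<Rightarrow> 'a" (infixr "\<^sub>H*" 75)
    and qinner :: "'a \<Rightarrow> 'a \<Rightarrow> quat"
  assumes rscale_add_left: "(x + y) *\<^sub>H q = x *\<^sub>H q + y *\<^sub>H q"
    and rscale_add_right: "x *\<^sub>H (p + q) = x *\<^sub>H p + x *\<^sub>H q"
    and rscale_rscale: "(x *\<^sub>H p) *\<^sub>H q = x *\<^sub>H (p * q)"
    and rscale_of_real: "x *\<^sub>H of_real r = r *\<^sub>R x"
    and lscale_add_left: "(p + q) \<^sub>H* x = p \<^sub>H* x + q \<^sub>H* x"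
    and lscale_add_right: "q \<^sub>H* (x + y) = q \<^sub>H* x + q \<^sub>H* y"
    and lscale_lscale: "p \<^sub>H* (q \<^sub>H* x) = (p * q) \<^sub>H* x"
    and lscale_of_real: "of_real r \<^sub>H* x = r *\<^sub>R x"
    and lscale_rscale: "(p \<^sub>H* x) *\<^sub>H q = p \<^sub>H* (x *\<^sub>H q)"
    and qinner_add_left: "qinner (x + y) z = qinner x z + qinner y z"
    and qinner_rscale: "qinner (x *\<^sub>H p) (y *\<^sub>H q) = qcnj q * qinner x y * p"
    and qinner_commute: "qinner y x = qcnj (qinner x y)"
    and qinner_ge_zero: "0 \<le> qRe (qinner x x)"
    and qinner_eq_zero_iff: "qinner x x = 0 \<longleftrightarrow> x = 0"
    and norm_eq_sqrt_qinner: "norm x = sqrt (qRe (qinner x x))"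

definition rspan :: "'a::quat_hilbert set \<Rightarrow> 'a set" where
  "rspan B = {\<Sum>b\<in>F. b *\<^sub>H c b | F c. finite F \<and> F \<subseteq> B}"

definition infinite_dimensional :: "'a::quat_hilbert itself \<Rightarrow> bool" where
  "infinite_dimensional _ \<longleftrightarrow> (\<forall>B :: 'a set. finite B \<longrightarrow> rspan B \<noteq> UNIV)"


section \<open>Operators and numerical ranges\<close>

definition bounded_ops :: "('a::quat_hilbert \<Rightarrow> 'a) set" where
  "bounded_ops = {T. bounded_linear T \<and> (\<forall>x q. T (x *\<^sub>H q) = T x *\<^sub>H q)}"

definition compact_ops :: "('a::quat_hilbert \<Rightarrow> 'a) set" where
  "compact_ops = {K \<in> bounded_ops. compact (closure (K ` cball 0 1))}"

definition numerical_range :: "('a::quat_hilbert \<Rightarrow> 'a) \<Rightarrow> quat set" where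
  "numerical_range T = {qinner (T x) x | x. norm x = 1}"

definition essential_numerical_range :: "('a::quat_hilbert \<Rightarrow> 'a) \<Rightarrow> quat set" where
  "essential_numerical_range T = (\<Inter>K\<in>compact_ops. closure (numerical_range (\<lambda>x. T x + K x)))"

definition iconv :: "quat set \<Rightarrow> quat set \<Rightarrow> quat set" where
  "iconv A B = {\<alpha> *\<^sub>R a + (1 - \<alpha>) *\<^sub>R b | \<alpha> a b. a \<in> A \<and> b \<in> B \<and> 0 \<le> \<alpha> \<and> \<alpha> \<le> 1}"

end

theory Submission
  imports Defs
begin

text \<open>
The theorem follows from an approximate orthogonal decomposition of the quadratic form
\<open>\<langle>Tx, x\<rangle>\<close>.  For a finite set \<open>F\<close> let \<open>tail_range T F\<close> be the set of its values on unit vectors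
orthogonal to \<open>F\<close>, and let \<open>limit_range T\<close> be the intersection of the closures of these sets.  It
consists of the values that are approached along unit vectors escaping every finite set.

If \<open>y\<close> is a unit vector and \<open>x\<close> is a unit vector orthogonal to \<open>y\<close>, \<open>Ty\<close> and \<open>T*y\<close>, then all cross
terms in the form at \<open>\<surd>\<alpha> x + \<surd>(1 - \<alpha>) y\<close> vanish, and its value is the convex combination of the
values at \<open>x\<close> and \<open>y\<close>.  So every convex combination of a point of \<open>limit_range T\<close> and a point of
\<open>tail_range T F\<close> lies in the closure of \<open>tail_range T F\<close> (\<open>limit_range_combination\<close>).  With
\<open>F = {}\<close> this is one inclusion of the theorem for \<open>limit_range T\<close> in place of the essential
numerical range; it also makes \<open>limit_range T\<close> convex, although quaternionic numerical ranges
need not be.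

For the other inclusion let \<open>a\<close> be the limit of \<open>\<langle>T x\<^sub>n, x\<^sub>n\<rangle>\<close> with unit vectors \<open>x\<^sub>n\<close>, and let \<open>x\<close> be a
weak cluster point of the sequence.  Along suitable indices the cross terms between \<open>x\<close> and
\<open>d = x\<^sub>n - x\<close> tend to zero, so \<open>\<langle>Td, d\<rangle>\<close> tends to \<open>a - \<langle>Tx, x\<rangle>\<close> and the squared norm of \<open>d\<close> to
\<open>1 - \<parallel>x\<parallel>\<^sup>2\<close>, while \<open>d\<close> tends weakly to zero.  If \<open>0 < \<parallel>x\<parallel> < 1\<close>, normalisation writes \<open>a\<close> as a
combination of a point of \<open>limit_range T\<close> with weight \<open>1 - \<parallel>x\<parallel>\<^sup>2\<close> and the value at \<open>x / \<parallel>x\<parallel>\<close>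
(\<open>closure_numerical_range_subset\<close>).  If \<open>x = 0\<close>, then \<open>a\<close> itself is in \<open>limit_range T\<close>, and if \<open>\<parallel>x\<parallel> = 1\<close>,
the convergence is in norm and \<open>a\<close> is attained at \<open>x\<close>.

It remains to identify \<open>limit_range T\<close> with the essential numerical range.  A compact operator maps
the unit ball near a finite set \<open>F\<close>, so it contributes little to the form on unit vectors orthogonal
to \<open>F\<close>; this gives one inclusion.  Conversely, let \<open>P\<close> be the orthogonal projection onto the span
of a finite orthonormal set.  A finite rank perturbation turns \<open>T\<close> into \<open>rP + (1-P)T(1-P)\<close>, whose
values are convex combinations of \<open>r\<close> and values of \<open>T\<close> on the complement, provided that \<open>r\<close> is real:
for other quaternions the form of \<open>x \<mapsto> x r\<close> takes conjugates of \<open>r\<close> and their averages as values.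
If moreover \<open>r\<close> belongs to \<open>limit_range T\<close>, \<open>limit_range_combination\<close> shows that these combinations stay in the
closure.  Such an \<open>r\<close> exists, since the real part of a quaternion is the average of
its conjugates by \<open>1, i, j, k\<close> and \<open>limit_range T\<close> is nonempty, convex and invariant under
conjugation by unit quaternions.
\<close>

section \<open>Quaternion arithmetic\<close>

lemma quat_mult_sel [simp]:
  "qRe (p * q) = qRe p * qRe q - qI p * qI q - qJ p * qJ q - qK p * qK q"
  "qI (p * q) = qRe p * qI q + qI p * qRe q + qJ p * qK q - qK p * qJ q"
  "qJ (p * q) = qRe p * qJ q - qI p * qK q + qJ p * qRe q + qK p * qI q"
  "qK (p * q) = qRe p * qK q + qI p * qJ q - qJ p * qI q + qK p * qRe q"
  by (simp_all add: times_quat_def)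

lemma quat_scaleR_sel [simp]:
  "qRe (r *\<^sub>R q) = r * qRe q" "qI (r *\<^sub>R q) = r * qI q"
  "qJ (r *\<^sub>R q) = r * qJ q" "qK (r *\<^sub>R q) = r * qK q"
  by (simp_all add: scaleR_quat_def)

lemma quat_of_real_sel [simp]:
  "qRe (of_real r) = r" "qI (of_real r) = 0" "qJ (of_real r) = 0" "qK (of_real r) = 0"
  by (simp_all add: of_real_def)

text \<open>
The Euclidean structure is what makes closed balls of quaternions compact.
\<close>

instantiation quat :: euclidean_space
begin

definition "Basis = {Quat 1 0 0 0, Quat 0 1 0 0, Quat 0 0 1 0, Quat 0 0 0 1}"

instance
proof
  show "(\<forall>u\<in>Basis. inner x u = 0) \<longleftrightarrow> x = 0" for x :: quat
    by (simp add: Basis_quat_def inner_quat_def) (simp add: quat_eq_iff)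
  show "inner u v = (if u = v then 1 else 0)" if "u \<in> Basis" "v \<in> Basis" for u v :: quat
    using that unfolding Basis_quat_def inner_quat_def quat_eq_iff
    by (elim insertE emptyE) simp_all
qed (simp_all add: Basis_quat_def)

end

lemma qcnj_simps [simp]:
  "qcnj (qcnj p) = p" "qcnj 0 = 0" "qcnj 1 = 1" "qcnj (p + q) = qcnj p + qcnj q"
  "qcnj (p - q) = qcnj p - qcnj q" "qcnj (- p) = - qcnj p" "qcnj (of_real r) = of_real r"
  "qcnj (r *\<^sub>R p) = r *\<^sub>R qcnj p"
  by (simp_all add: quat_eq_iff)

lemma norm_quat_sq: "(norm q)\<^sup>2 = (qRe q)\<^sup>2 + (qI q)\<^sup>2 + (qJ q)\<^sup>2 + (qK q)\<^sup>2"
  by (simp add: norm_quat_def inner_quat_def power2_eq_square)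

lemma norm_qcnj [simp]: "norm (qcnj q) = norm q"
  by (simp add: norm_quat_def inner_quat_def)

lemma qcnj_mult_self: "qcnj q * q = of_real ((norm q)\<^sup>2)"
  using norm_quat_sq[of q] by (simp add: quat_eq_iff power2_eq_square algebra_simps)

lemma abs_qRe_le_norm: "\<bar>qRe q\<bar> \<le> norm q"
proof (rule power2_le_imp_le)
  show "\<bar>qRe q\<bar>\<^sup>2 \<le> (norm q)\<^sup>2"
    by (simp add: norm_quat_sq)
qed simp

lemma bounded_linear_qRe: "bounded_linear qRe"
  by (rule bounded_linear_intro[where K = 1]) (simp_all add: abs_qRe_le_norm)

lemma of_real_quat_commute: "of_real r * (q :: quat) = q * of_real r"
  by (simp add: quat_eq_iff)

lemma quat_eqI_qRe_mult:
  assumes "\<And>u. qRe (p * u) = qRe (q * u)"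
  shows "p = q"
  using assms[of 1] assms[of "Quat 0 1 0 0"] assms[of "Quat 0 0 1 0"] assms[of "Quat 0 0 0 1"]
  by (simp add: quat_eq_iff)

text \<open>
Conjugation by \<open>1, i, j, k\<close> flips the sign of each imaginary coordinate exactly twice.  The average
is nested in pairs so that it can be read off from closure under midpoints.
\<close>

lemma average_of_conjugates:
  fixes q :: quat
  defines "c \<equiv> \<lambda>u. qcnj u * q * u"
  shows "(1/2) *\<^sub>R ((1/2) *\<^sub>R c 1 + (1/2) *\<^sub>R c (Quat 0 1 0 0))
    + (1/2) *\<^sub>R ((1/2) *\<^sub>R c (Quat 0 0 1 0) + (1/2) *\<^sub>R c (Quat 0 0 0 1)) = of_real (qRe q)"
  by (simp add: c_def quat_eq_iff)

section \<open>Quaternionic inner product\<close>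

lemma rscale_one [simp]: "(x :: 'a::quat_hilbert) *\<^sub>H 1 = x"
  using rscale_of_real[of x 1] by simp

lemma rscale_zero_right [simp]: "(x :: 'a::quat_hilbert) *\<^sub>H 0 = 0"
  using rscale_of_real[of x 0] by simp

lemma rscale_zero_left [simp]: "(0 :: 'a::quat_hilbert) *\<^sub>H q = 0"
  using rscale_add_left[of 0 0 q] by simp

lemma qinner_rscale_left: "qinner (x *\<^sub>H p) y = qinner x y * p"
  using qinner_rscale[of x p y 1] by simp

lemma qinner_rscale_right: "qinner x (y *\<^sub>H q) = qcnj q * qinner x y"
  using qinner_rscale[of x 1 y q] by simp

lemma qinner_add_right: "qinner x (y + z) = qinner x y + qinner x z"
  by (metis qinner_commute qinner_add_left qcnj_simps(4))

lemma qinner_scaleR_left: "qinner (r *\<^sub>R x) y = r *\<^sub>R qinner x y"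
  by (simp add: rscale_of_real[symmetric] qinner_rscale_left of_real_quat_commute[symmetric]
      scaleR_conv_of_real[symmetric])

lemma qinner_scaleR_right: "qinner x (r *\<^sub>R y) = r *\<^sub>R qinner x y"
  by (simp add: rscale_of_real[symmetric] qinner_rscale_right scaleR_conv_of_real[symmetric])

lemma qinner_diff_left: "qinner (x - y) z = qinner x z - qinner y z"
  by (metis add_diff_cancel_right' diff_add_cancel qinner_add_left)

lemma qinner_diff_right: "qinner x (y - z) = qinner x y - qinner x z"
  by (metis add_diff_cancel_right' diff_add_cancel qinner_add_right)

lemma qinner_zero_left [simp]: "qinner 0 x = 0"
  using qinner_add_left[of 0 0 x] by simp

lemma qinner_zero_right [simp]: "qinner x 0 = 0"
  using qinner_add_right[of x 0 0] by simp

lemma qinner_sum_left: "qinner (\<Sum>i\<in>I. f i) y = (\<Sum>i\<in>I. qinner (f i) y)"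
  by (induction I rule: infinite_finite_induct) (simp_all add: qinner_add_left)

lemma qinner_eq_0_sym: "qinner x y = 0 \<longleftrightarrow> qinner y x = 0"
  by (metis qinner_commute qcnj_simps(1,2))

lemma norm_sq_eq_qRe: "(norm x)\<^sup>2 = qRe (qinner x x)"
  by (simp add: norm_eq_sqrt_qinner qinner_ge_zero)

lemma qinner_self: "qinner x x = of_real ((norm x)\<^sup>2)"
proof -
  have "qinner x x = qcnj (qinner x x)" by (rule qinner_commute)
  then show ?thesis by (simp add: quat_eq_iff norm_sq_eq_qRe)
qed

lemma norm_add_sq: "(norm (x + y))\<^sup>2 = (norm x)\<^sup>2 + 2 * qRe (qinner x y) + (norm y)\<^sup>2"
proof -
  have "qRe (qinner y x) = qRe (qinner x y)" by (metis qinner_commute quat_sel(21))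
  then show ?thesis
    by (simp add: norm_sq_eq_qRe qinner_add_left qinner_add_right)
qed

lemma norm_add_sq_orthogonal: "qinner x y = 0 \<Longrightarrow> (norm (x + y))\<^sup>2 = (norm x)\<^sup>2 + (norm y)\<^sup>2"
  by (simp add: norm_add_sq)

lemma norm_rscale_sq: "(norm (x *\<^sub>H u))\<^sup>2 = (norm x)\<^sup>2 * (norm u)\<^sup>2"
proof -
  have "qinner (x *\<^sub>H u) (x *\<^sub>H u) = of_real ((norm x)\<^sup>2) * (qcnj u * u)"
    by (metis mult.assoc of_real_quat_commute qinner_rscale qinner_self)
  also have "\<dots> = of_real ((norm x)\<^sup>2 * (norm u)\<^sup>2)"
    by (simp only: qcnj_mult_self of_real_mult)
  finally show ?thesis
    by (simp only: norm_sq_eq_qRe[of "x *\<^sub>H u"] quat_of_real_sel)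
qed

lemma norm_rscale: "norm (x *\<^sub>H u) = norm x * norm u"
  using norm_rscale_sq[of x u] by (simp flip: power_mult_distrib)

lemma qinner_Cauchy_Schwarz: "norm (qinner x y) \<le> norm x * norm y"
proof (cases "y = 0")
  case False
  define s where "s = (norm y)\<^sup>2"
  have s: "s > 0" using False by (simp add: s_def)
  define q where "q = inverse s *\<^sub>R qinner x y"
  define z where "z = x - y *\<^sub>H q"
  have "qinner y y * q = qinner x y"
    using s by (simp add: q_def qinner_self flip: scaleR_conv_of_real s_def)
  then have "qinner z (y *\<^sub>H q) = 0"
    by (simp add: z_def qinner_diff_left qinner_rscale_left qinner_rscale_right algebra_simps)
  from norm_add_sq_orthogonal[OF this] have "(norm x)\<^sup>2 = (norm z)\<^sup>2 + s * (norm q)\<^sup>2"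
    by (simp add: z_def norm_rscale_sq s_def)
  then have "s * (norm q)\<^sup>2 \<le> (norm x)\<^sup>2" by simp
  moreover have "s * (norm q)\<^sup>2 * s = (norm (qinner x y))\<^sup>2"
    using s by (simp add: q_def power_mult_distrib power2_eq_square)
  ultimately have "(norm (qinner x y))\<^sup>2 \<le> (norm x)\<^sup>2 * s"
    using s mult_right_mono[of "s * (norm q)\<^sup>2" "(norm x)\<^sup>2" s] by simp
  then have "(norm (qinner x y))\<^sup>2 \<le> (norm x * norm y)\<^sup>2"
    by (simp add: s_def power_mult_distrib)
  then show ?thesis
    by (rule power2_le_imp_le) simp
qed simp

lemma bounded_bilinear_qinner: "bounded_bilinear qinner"
proof (rule bounded_bilinear.intro)
  show "\<exists>K. \<forall>x y. norm (qinner x y :: quat) \<le> norm x * norm y * K"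
    by (rule exI[of _ 1]) (simp add: qinner_Cauchy_Schwarz)
qed (simp_all add: qinner_add_left qinner_add_right qinner_scaleR_left qinner_scaleR_right)

lemma parallelogram_midpoint:
  "(norm ((1/2) *\<^sub>R (x + y)))\<^sup>2 = ((norm x)\<^sup>2 + (norm y)\<^sup>2) / 2 - (norm (x - y))\<^sup>2 / (4 :: real)"
  for x y :: "'a::quat_hilbert"
proof -
  have "(norm (x - y))\<^sup>2 = (norm x)\<^sup>2 - 2 * qRe (qinner x y) + (norm y)\<^sup>2"
    using norm_add_sq[of x "- y"] qinner_diff_right[of x 0 y] by simp
  moreover have "(norm ((1/2) *\<^sub>R (x + y)))\<^sup>2 = (norm (x + y))\<^sup>2 / 4"
    by (simp only: norm_scaleR power_mult_distrib) (simp add: power_divide)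
  moreover note norm_add_sq[of x y]
  ultimately show ?thesis
    by argo
qed

section \<open>Riesz representation and adjoints\<close>

text \<open>
The representing vector minimises \<open>\<parallel>z\<parallel>\<^sup>2 - 2 Re \<phi>(z)\<close>: if \<open>\<phi>\<close> is represented by \<open>w\<close>, this is
\<open>\<parallel>z - w\<parallel>\<^sup>2 - \<parallel>w\<parallel>\<^sup>2\<close>.  Minimising sequences are Cauchy by the parallelogram law, and the first variation
at the minimum identifies the real parts of \<open>\<phi>\<close> and of \<open>\<langle>\<cdot>, w\<rangle>\<close>.  Right linearity
recovers the remaining coordinates.
\<close>

theorem Riesz_representation:
  fixes \<phi> :: "'a::quat_hilbert \<Rightarrow> quat"
  assumes add: "\<And>x y. \<phi> (x + y) = \<phi> x + \<phi> y"
    and hom: "\<And>x q. \<phi> (x *\<^sub>H q) = \<phi> x * q"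
    and bound: "\<And>x. norm (\<phi> x) \<le> C * norm x"
  obtains z where "\<And>x. \<phi> x = qinner x z"
proof -
  have scale: "\<phi> (r *\<^sub>R x) = r *\<^sub>R \<phi> x" for r x
    by (simp add: rscale_of_real[symmetric] hom of_real_quat_commute[symmetric]
        scaleR_conv_of_real[symmetric])
  have lin: "bounded_linear \<phi>"
    by (rule bounded_linear_intro[where K = C]) (simp_all add: add scale bound mult.commute)
  define J where "J z = (norm z)\<^sup>2 - 2 * qRe (\<phi> z)" for z
  have J_ge: "- C\<^sup>2 \<le> J z" for z
  proof -
    have "qRe (\<phi> z) \<le> C * norm z" using abs_qRe_le_norm[of "\<phi> z"] bound[of z] by linarith
    moreover have "0 \<le> (norm z - C)\<^sup>2" by simp
    ultimately show ?thesis by (simp add: J_def power2_eq_square algebra_simps)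
  qed
  define m where "m = Inf (range J)"
  have bdd: "bdd_below (range J)" using J_ge by (auto intro!: bdd_belowI)
  then have m_le: "m \<le> J z" for z by (simp add: m_def cInf_lower)
  have mid: "J ((1/2) *\<^sub>R (x + y)) = (J x + J y) / 2 - (norm (x - y))\<^sup>2 / 4" for x y
    unfolding J_def parallelogram_midpoint by (simp add: scale add field_simps)
  have "\<exists>z. J z < m + inverse (real (Suc n))" for n
    using cInf_lessD[of "range J" "m + inverse (real (Suc n))"] by (auto simp: m_def simp del: of_nat_Suc)
  then obtain z where z: "\<And>n. J (z n) < m + inverse (real (Suc n))" by metis
  have J_lim: "(\<lambda>n. J (z n)) \<longlonglongrightarrow> m"
  proof (rule tendsto_sandwich[OF _ _ tendsto_const])
    show "(\<lambda>n. m + inverse (real (Suc n))) \<longlonglongrightarrow> m"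
      using tendsto_add[OF tendsto_const LIMSEQ_inverse_real_of_nat] by simp
  qed (auto intro!: always_eventually m_le less_imp_le z simp del: of_nat_Suc)
  have "Cauchy z"
  proof (rule metric_CauchyI)
    fix e :: real assume e: "e > 0"
    then have "\<forall>\<^sub>F n in sequentially. J (z n) < m + e\<^sup>2 / 4"
      using J_lim by (intro order_tendstoD(2)) auto
    then obtain N where N: "\<And>n. n \<ge> N \<Longrightarrow> J (z n) < m + e\<^sup>2 / 4"
      by (auto simp: eventually_sequentially)
    have "dist (z i) (z j) < e" if "i \<ge> N" "j \<ge> N" for i j
    proof -
      have "(norm (z i - z j))\<^sup>2 < e\<^sup>2"
        using mid[of "z i" "z j"] m_le[of "(1/2) *\<^sub>R (z i + z j)"] N[OF that(1)] N[OF that(2)] by argo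
      then show ?thesis using e by (simp add: dist_norm power_less_imp_less_base)
    qed
    then show "\<exists>N. \<forall>i\<ge>N. \<forall>j\<ge>N. dist (z i) (z j) < e" by blast
  qed
  then obtain w where w: "z \<longlonglongrightarrow> w" by (auto simp: Cauchy_convergent_iff convergent_def)
  have "(\<lambda>n. J (z n)) \<longlonglongrightarrow> J w"
    unfolding J_def by (intro tendsto_intros w bounded_linear.tendsto[OF bounded_linear_qRe] bounded_linear.tendsto[OF lin])
  with J_lim have Jw: "J w = m" by (rule LIMSEQ_unique[rotated])
  (* The first variation: J is a quadratic polynomial on each line through the minimiser w. *)
  have re: "qRe (\<phi> x) = qRe (qinner x w)" for x
  proof -
    define d where "d = qRe (\<phi> x) - qRe (qinner x w)"
    have "qRe (qinner w x) = qRe (qinner x w)" by (metis qinner_commute quat_sel(21))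
    then have *: "0 \<le> t\<^sup>2 * (norm x)\<^sup>2 - 2 * t * d" for t
      using m_le[of "w + t *\<^sub>R x"] Jw
      by (simp add: J_def norm_add_sq add scale qinner_scaleR_right power_mult_distrib d_def algebra_simps)
    (* Adding 1 keeps s positive for x = 0; the choice t = d / s makes the polynomial
       negative unless d vanishes. *)
    define s where "s = (norm x)\<^sup>2 + 1"
    have s: "s > 0" "(norm x)\<^sup>2 = s - 1" by (simp_all add: s_def add_nonneg_pos)
    have "0 \<le> s\<^sup>2 * ((d / s)\<^sup>2 * (s - 1) - 2 * (d / s) * d)"
      using *[of "d / s"] s by simp
    also have "\<dots> = - (d\<^sup>2 * (s + 1))"
      using s(1) by (simp add: field_simps power2_eq_square)
    finally have "d\<^sup>2 * (s + 1) \<le> 0" by simp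
    then have "d = 0" using s(1) by (simp add: mult_le_0_iff)
    then show ?thesis by (simp add: d_def)
  qed
  have "\<phi> x = qinner x w" for x
  proof (rule quat_eqI_qRe_mult)
    show "qRe (\<phi> x * u) = qRe (qinner x w * u)" for u
      using re[of "x *\<^sub>H u"] by (simp only: hom qinner_rscale_left)
  qed
  then show thesis by (rule that)
qed

text \<open>
The vector \<open>t\<close> is \<open>T*y\<close>.  Only single values of the adjoint are needed, to turn the condition
\<open>\<langle>Tx, y\<rangle> = 0\<close> into orthogonality of \<open>x\<close> to a fixed vector.
\<close>

lemma adjoint_vector:
  assumes "T \<in> bounded_ops"
  obtains t where "\<And>x. qinner (T x) y = qinner x t"
proof -
  have T: "bounded_linear T" "\<And>x q. T (x *\<^sub>H q) = T x *\<^sub>H q"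
    using assms by (auto simp: bounded_ops_def)
  have bd: "norm (qinner (T x) y) \<le> (onorm T * norm y) * norm x" for x
    using qinner_Cauchy_Schwarz[of "T x" y] mult_right_mono[OF onorm[OF T(1), of x], of "norm y"]
    by (simp add: mult_ac)
  have add: "T (x + z) = T x + T z" for x z
    using T(1) by (simp add: bounded_linear.linear linear_add)
  show thesis
  proof (rule Riesz_representation[where \<phi> = "\<lambda>x. qinner (T x) y" and C = "onorm T * norm y"])
    show "qinner (T (x *\<^sub>H q)) y = qinner (T x) y * q" for x q
      by (simp add: T(2) qinner_rscale_left)
  qed (simp_all add: add bd qinner_add_left that)
qed

section \<open>Orthogonal complements of finite sets and compact operators\<close>

definition qperp :: "'a::quat_hilbert set \<Rightarrow> 'a set" where
  "qperp F = {x. \<forall>y\<in>F. qinner x y = 0}"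

definition qorthonormal :: "'a::quat_hilbert set \<Rightarrow> bool" where
  "qorthonormal B \<longleftrightarrow> (\<forall>b\<in>B. \<forall>c\<in>B. qinner b c = (if b = c then 1 else 0))"

definition qproj :: "'a::quat_hilbert set \<Rightarrow> 'a \<Rightarrow> 'a" where
  "qproj B x = (\<Sum>b\<in>B. b *\<^sub>H qinner x b)"

lemma qperpD: "x \<in> qperp F \<Longrightarrow> y \<in> F \<Longrightarrow> qinner x y = 0" "x \<in> qperp F \<Longrightarrow> y \<in> F \<Longrightarrow> qinner y x = 0"
  by (simp_all add: qperp_def qinner_eq_0_sym[of y])

lemma qperp_scaleR: "x \<in> qperp F \<Longrightarrow> r *\<^sub>R x \<in> qperp F"
  by (simp add: qperp_def qinner_scaleR_left)

lemma qperp_rscale: "x \<in> qperp F \<Longrightarrow> x *\<^sub>H q \<in> qperp F"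
  by (simp add: qperp_def qinner_rscale_left)

lemma qperp_add: "x \<in> qperp F \<Longrightarrow> y \<in> qperp F \<Longrightarrow> x + y \<in> qperp F"
  by (simp add: qperp_def qinner_add_left)

lemma qperp_antimono: "F \<subseteq> G \<Longrightarrow> qperp G \<subseteq> qperp F"
  by (auto simp: qperp_def)

lemma qinner_qproj_eq:
  assumes "finite B" "qorthonormal B" "c \<in> B"
  shows "qinner (qproj B x) c = qinner x c"
proof -
  have "qinner (qproj B x) c = (\<Sum>b\<in>B. if b = c then qinner x b else 0)"
    unfolding qproj_def qinner_sum_left
    using assms(2,3) by (intro sum.cong) (auto simp: qinner_rscale_left qorthonormal_def)
  then show ?thesis using assms(1,3) by simp
qed

lemma minus_qproj_perp: "finite B \<Longrightarrow> qorthonormal B \<Longrightarrow> x - qproj B x \<in> qperp B"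
  by (simp add: qperp_def qinner_diff_left qinner_qproj_eq)

lemma qinner_qproj_perp:
  assumes "z \<in> qperp B"
  shows "qinner (qproj B x) z = 0" "qinner z (qproj B x) = 0"
proof -
  show *: "qinner (qproj B x) z = 0"
    using assms by (simp add: qproj_def qinner_sum_left qinner_rscale_left qperpD)
  show "qinner z (qproj B x) = 0"
    by (subst qinner_eq_0_sym) (rule *)
qed

lemma norm_sq_qproj:
  assumes "finite B" "qorthonormal B"
  shows "(norm x)\<^sup>2 = (norm (qproj B x))\<^sup>2 + (norm (x - qproj B x))\<^sup>2"
  using norm_add_sq_orthogonal[OF qinner_qproj_perp(1)[OF minus_qproj_perp[OF assms]], of x x] by simp

text \<open>
Gram--Schmidt: the new vector is the normalised component of \<open>f\<close> orthogonal to the vectors found so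
far, and none is added when that component vanishes.
\<close>

lemma finite_set_orthonormalise:
  assumes "finite (F :: 'a::quat_hilbert set)"
  shows "\<exists>B. finite B \<and> qorthonormal B \<and> qperp B \<subseteq> qperp F"
  using assms
proof (induction F rule: finite_induct)
  case empty
  show ?case by (rule exI[of _ "{}"]) (simp add: qorthonormal_def)
next
  case (insert f F)
  then obtain B where B: "finite B" "qorthonormal B" "qperp B \<subseteq> qperp F" by blast
  define g where "g = f - qproj B f"
  have g: "g \<in> qperp B" using B by (simp add: g_def minus_qproj_perp)
  have f: "qinner x f = qinner x g" if "x \<in> qperp B" for x
    using that by (simp add: g_def qinner_diff_right qinner_qproj_perp)
  show ?case
  proof (cases "g = 0")
    case True
    then have "qperp B \<subseteq> qperp (insert f F)"
      using f B(3) by (auto simp: qperp_def)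
    with B show ?thesis by blast
  next
    case False
    define e where "e = (1 / norm g) *\<^sub>R g"
    have e: "e \<in> qperp B" "norm e = 1" using g False by (simp_all add: e_def qperp_scaleR)
    have ge: "g = norm g *\<^sub>R e" using False by (simp add: e_def)
    have "e \<notin> B" using qperpD(1)[OF e(1), of e] e(2) by (auto simp: qinner_self)
    then have "qorthonormal (insert e B)"
      using B(2) qperpD[OF e(1)] e(2) by (auto simp: qorthonormal_def qinner_self)
    moreover have "qperp (insert e B) \<subseteq> qperp (insert f F)"
    proof
      fix x assume x: "x \<in> qperp (insert e B)"
      then have "x \<in> qperp B" "qinner x e = 0" by (auto simp: qperp_def)
      moreover from this have "qinner x f = 0" by (subst f, simp, subst ge) (simp add: qinner_scaleR_right)
      ultimately show "x \<in> qperp (insert f F)" using B(3) by (auto simp: qperp_def)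
    qed
    ultimately show ?thesis using B(1) by blast
  qed
qed

lemma unit_vector_in_qperp:
  assumes "infinite_dimensional TYPE('a::quat_hilbert)" "finite (F :: 'a set)"
  obtains x where "norm x = 1" "x \<in> qperp F"
proof -
  obtain B where B: "finite B" "qorthonormal B" "qperp B \<subseteq> qperp F"
    using finite_set_orthonormalise[OF assms(2)] by blast
  then obtain u where u: "u \<notin> rspan B"
    using assms(1) by (auto simp: infinite_dimensional_def)
  have "qproj B u \<in> rspan B" using B(1) unfolding rspan_def qproj_def by blast
  with u have "u - qproj B u \<noteq> 0" by auto
  then have "norm ((1 / norm (u - qproj B u)) *\<^sub>R (u - qproj B u)) = 1" by simp
  moreover have "(1 / norm (u - qproj B u)) *\<^sub>R (u - qproj B u) \<in> qperp F"
    using minus_qproj_perp[OF B(1,2)] B(3) qperp_scaleR by blast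
  ultimately show thesis by (rule that)
qed

lemma bounded_ops_bounded_linear: "T \<in> bounded_ops \<Longrightarrow> bounded_linear T"
  by (simp add: bounded_ops_def)

lemma bounded_ops_rscale: "T \<in> bounded_ops \<Longrightarrow> T (x *\<^sub>H q) = T x *\<^sub>H q"
  by (simp add: bounded_ops_def)

lemma bounded_ops_linear: "T \<in> bounded_ops \<Longrightarrow> linear T"
  by (simp add: bounded_ops_bounded_linear bounded_linear.linear)

lemmas bounded_opsD = bounded_ops_bounded_linear bounded_ops_rscale
  linear_add[OF bounded_ops_linear] linear_diff[OF bounded_ops_linear]
  linear_cmul[OF bounded_ops_linear] linear_0[OF bounded_ops_linear]
  linear_sum[OF bounded_ops_linear]

lemma rscale_diff_left: "((x :: 'a::quat_hilbert) - y) *\<^sub>H q = x *\<^sub>H q - y *\<^sub>H q"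
  by (metis add_diff_cancel_right' diff_add_cancel rscale_add_left)

lemma rscale_scaleR_left: "(r *\<^sub>R (x :: 'a::quat_hilbert)) *\<^sub>H q = r *\<^sub>R (x *\<^sub>H q)"
  by (simp add: rscale_of_real[symmetric] rscale_rscale of_real_quat_commute)

lemma bounded_ops_add: "S \<in> bounded_ops \<Longrightarrow> T \<in> bounded_ops \<Longrightarrow> (\<lambda>x. S x + T x) \<in> bounded_ops"
  by (simp add: bounded_ops_def bounded_linear_add rscale_add_left)

lemma bounded_ops_diff: "S \<in> bounded_ops \<Longrightarrow> T \<in> bounded_ops \<Longrightarrow> (\<lambda>x. S x - T x) \<in> bounded_ops"
  by (simp add: bounded_ops_def bounded_linear_sub rscale_diff_left)

lemma bounded_ops_compose: "S \<in> bounded_ops \<Longrightarrow> T \<in> bounded_ops \<Longrightarrow> (\<lambda>x. S (T x)) \<in> bounded_ops"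
  by (simp add: bounded_ops_def bounded_linear_compose)

lemma bounded_ops_id: "(\<lambda>x. x) \<in> bounded_ops"
  by (simp add: bounded_ops_def bounded_linear_ident)

lemma compact_opsI:
  assumes "K \<in> bounded_ops" "compact C" "\<And>x. norm x \<le> 1 \<Longrightarrow> K x \<in> C"
  shows "K \<in> compact_ops"
proof -
  have "closure (K ` cball 0 1) \<subseteq> C"
    using assms by (intro closure_minimal compact_imp_closed) auto
  then have "compact (closure (K ` cball 0 1))"
    using compact_Int_closed[OF assms(2) closed_closure[of "K ` cball 0 1"]] by (simp add: Int_absorb1)
  with assms(1) show ?thesis by (simp add: compact_ops_def)
qed

lemma compact_opsE:
  assumes "K \<in> compact_ops"
  obtains C where "compact C" "\<And>x. norm x \<le> 1 \<Longrightarrow> K x \<in> C"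
proof (rule that)
  show "compact (closure (K ` cball 0 1))" using assms by (simp add: compact_ops_def)
  show "K x \<in> closure (K ` cball 0 1)" if "norm x \<le> 1" for x
    using that by (intro subsetD[OF closure_subset] imageI) simp
qed

lemma compact_ops_bounded: "K \<in> compact_ops \<Longrightarrow> K \<in> bounded_ops"
  by (simp add: compact_ops_def)

lemma compact_ops_add:
  assumes "K \<in> compact_ops" "L \<in> compact_ops"
  shows "(\<lambda>x. K x + L x) \<in> compact_ops"
proof -
  obtain C where C: "compact C" "\<And>x. norm x \<le> 1 \<Longrightarrow> K x \<in> C"
    using assms(1) by (rule compact_opsE) blast
  obtain D where D: "compact D" "\<And>x. norm x \<le> 1 \<Longrightarrow> L x \<in> D"
    using assms(2) by (rule compact_opsE) blast
  show ?thesis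
  proof (rule compact_opsI)
    show "compact {x + y | x y. x \<in> C \<and> y \<in> D}" using C(1) D(1) by (rule compact_sums)
    show "K x + L x \<in> {x + y | x y. x \<in> C \<and> y \<in> D}" if "norm x \<le> 1" for x
      using C(2)[OF that] D(2)[OF that] by blast
  qed (intro bounded_ops_add compact_ops_bounded assms)
qed

lemma compact_ops_zero: "(\<lambda>x. 0) \<in> compact_ops"
  by (rule compact_opsI[where C = "{0}"]) (simp_all add: bounded_ops_def bounded_linear_zero)

lemma compact_ops_sum:
  "(\<And>i. i \<in> I \<Longrightarrow> K i \<in> compact_ops) \<Longrightarrow> (\<lambda>x. \<Sum>i\<in>I. K i x) \<in> compact_ops"
  by (induction I rule: infinite_finite_induct) (simp_all add: compact_ops_zero compact_ops_add)

lemma bounded_linear_rscale: "bounded_linear (\<lambda>q. (u :: 'a::quat_hilbert) *\<^sub>H q)"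
proof (rule bounded_linear_intro[where K = "norm u"])
  show "u *\<^sub>H (r *\<^sub>R q) = r *\<^sub>R (u *\<^sub>H q)" for r q
    by (simp add: rscale_of_real[symmetric] rscale_rscale scaleR_conv_of_real of_real_quat_commute)
qed (simp_all add: rscale_add_right norm_rscale)

lemma rank_one_compact:
  assumes "S \<in> bounded_ops"
  shows "(\<lambda>x. u *\<^sub>H qinner (S x) b) \<in> compact_ops"
proof -
  have S: "bounded_linear S" "\<And>x q. S (x *\<^sub>H q) = S x *\<^sub>H q" using assms by (auto simp: bounded_ops_def)
  have \<phi>: "bounded_linear (\<lambda>x. qinner (S x) b)"
    using bounded_linear_compose[OF bounded_bilinear.bounded_linear_left[OF bounded_bilinear_qinner] S(1)] .
  show ?thesis
  proof (rule compact_opsI)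
    show "(\<lambda>x. u *\<^sub>H qinner (S x) b) \<in> bounded_ops"
      using bounded_linear_compose[OF bounded_linear_rscale \<phi>]
      by (simp add: bounded_ops_def S(2) qinner_rscale_left rscale_rscale)
    show "compact ((\<lambda>q. u *\<^sub>H q) ` cball 0 (onorm (\<lambda>x. qinner (S x) b)))"
      by (intro compact_continuous_image compact_cball linear_continuous_on bounded_linear_rscale)
    fix x :: 'a assume "norm x \<le> 1"
    then have "onorm (\<lambda>x. qinner (S x) b) * norm x \<le> onorm (\<lambda>x. qinner (S x) b)"
      using onorm_pos_le[OF \<phi>] by (rule mult_left_le)
    then have "norm (qinner (S x) b) \<le> onorm (\<lambda>x. qinner (S x) b)"
      using onorm[OF \<phi>, of x] by linarith
    then show "u *\<^sub>H qinner (S x) b \<in> (\<lambda>q. u *\<^sub>H q) ` cball 0 (onorm (\<lambda>x. qinner (S x) b))"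
      by simp
  qed
qed

section \<open>Values of the quadratic form on orthogonal complements\<close>

text \<open>
Excluding finite sets, instead of following weakly null sequences, leaves the freedom to
impose finitely many further orthogonality conditions at any moment.
\<close>

definition tail_range :: "('a::quat_hilbert \<Rightarrow> 'a) \<Rightarrow> 'a set \<Rightarrow> quat set" where
  "tail_range T F = {qinner (T x) x | x. norm x = 1 \<and> x \<in> qperp F}"

definition limit_range :: "('a::quat_hilbert \<Rightarrow> 'a) \<Rightarrow> quat set" where
  "limit_range T = (\<Inter>F\<in>Collect finite. closure (tail_range T F))"

lemma tail_range_empty: "tail_range T {} = numerical_range T"
  by (simp add: tail_range_def numerical_range_def qperp_def)

lemma quadratic_form_scaleR:
  assumes "T \<in> bounded_ops"
  shows "qinner (T (r *\<^sub>R x)) (r *\<^sub>R x) = r\<^sup>2 *\<^sub>R qinner (T x) x"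
  using assms by (simp add: bounded_opsD qinner_scaleR_left qinner_scaleR_right power2_eq_square)

lemma normalised_in_tail_range:
  assumes "T \<in> bounded_ops" "z \<in> qperp F" "z \<noteq> 0"
  shows "inverse ((norm z)\<^sup>2) *\<^sub>R qinner (T z) z \<in> tail_range T F"
  using assms unfolding tail_range_def
  by (auto intro!: exI[of _ "(1 / norm z) *\<^sub>R z"] qperp_scaleR
      simp: quadratic_form_scaleR divide_inverse power_inverse)

text \<open>
All tail ranges lie in one compact ball of the quaternions, and finitely many of them have a common
point because in infinite dimension a unit vector can avoid any finite set.
\<close>

lemma limit_range_nonempty:
  assumes inf: "infinite_dimensional TYPE('a::quat_hilbert)" and T: "(T :: 'a \<Rightarrow> 'a) \<in> bounded_ops"
  shows "limit_range T \<noteq> {}"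
proof -
  define S where "S = cball (0 :: quat) (onorm T)"
  have sub: "tail_range T F \<subseteq> S" for F
  proof
    fix a assume "a \<in> tail_range T F"
    then obtain x where "a = qinner (T x) x" "norm x = 1" by (auto simp: tail_range_def)
    then show "a \<in> S"
      using qinner_Cauchy_Schwarz[of "T x" x] onorm[OF bounded_opsD(1)[OF T], of x] by (simp add: S_def)
  qed
  have "S \<inter> (\<Inter>F\<in>Collect finite. closure (tail_range T F)) \<noteq> {}"
  proof (rule compact_imp_fip_image)
    show "compact S" by (simp add: S_def)
    fix I' :: "'a set set" assume I': "finite I'" "I' \<subseteq> Collect finite"
    then have "finite (\<Union>I')" by auto
    then obtain x where x: "norm x = 1" "x \<in> qperp (\<Union>I')"
      using unit_vector_in_qperp[OF inf] by blast
    have "qinner (T x) x \<in> tail_range T F" if "F \<subseteq> \<Union>I'" for F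
      using x qperp_antimono[OF that] by (auto simp: tail_range_def)
    then have "qinner (T x) x \<in> closure (tail_range T F)" if "F \<in> I'" for F
      using that closure_subset by blast
    moreover have "qinner (T x) x \<in> S"
      using sub[of "{}"] x(1) by (auto simp: tail_range_def qperp_def)
    ultimately have "qinner (T x) x \<in> S \<inter> (\<Inter>F\<in>I'. closure (tail_range T F))"
      by blast
    then show "S \<inter> (\<Inter>F\<in>I'. closure (tail_range T F)) \<noteq> {}" by blast
  qed simp
  then show ?thesis by (auto simp: limit_range_def)
qed

text \<open>
When \<open>v\<close> is attained at \<open>y\<close>, the point \<open>e\<close> is approached on unit vectors orthogonal to \<open>y\<close>, \<open>Ty\<close> and
\<open>T*y\<close> as well.  Then \<open>y\<close> and \<open>Ty\<close> have no cross terms with them, and the weights \<open>\<surd>\<alpha>\<close> and \<open>\<surd>(1 - \<alpha>)\<close>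
produce exactly the convex combination.  Continuity in each of the two points extends this to
the closures.
\<close>

lemma limit_range_combination:
  assumes T: "T \<in> bounded_ops" and F: "finite F" and e: "e \<in> limit_range T"
    and v: "v \<in> closure (tail_range T F)" and \<alpha>: "0 \<le> \<alpha>" "\<alpha> \<le> 1"
  shows "\<alpha> *\<^sub>R e + (1 - \<alpha>) *\<^sub>R v \<in> closure (tail_range T F)"
proof -
  have step: "\<alpha> *\<^sub>R e + (1 - \<alpha>) *\<^sub>R v \<in> closure (tail_range T F)" if v: "v \<in> tail_range T F" for v
  proof -
    obtain y where y: "v = qinner (T y) y" "norm y = 1" "y \<in> qperp F"
      using v by (auto simp: tail_range_def)
    obtain t where t: "\<And>x. qinner (T x) y = qinner x t" using adjoint_vector[OF T] by blast
    have "finite (F \<union> {y, T y, t})" using F by simp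
    with e have e': "e \<in> closure (tail_range T (F \<union> {y, T y, t}))" unfolding limit_range_def by blast
    have "(\<lambda>w. \<alpha> *\<^sub>R w + (1 - \<alpha>) *\<^sub>R v) ` tail_range T (F \<union> {y, T y, t}) \<subseteq> tail_range T F"
    proof clarify
      fix w assume "w \<in> tail_range T (F \<union> {y, T y, t})"
      then obtain x where x: "w = qinner (T x) x" "norm x = 1" "x \<in> qperp (F \<union> {y, T y, t})"
        by (auto simp: tail_range_def)
      then have o: "qinner x y = 0" "qinner (T y) x = 0" "qinner (T x) y = 0" "x \<in> qperp F"
        unfolding t by (auto simp: qperp_def qinner_eq_0_sym[of "T y" x])
      define z where "z = sqrt \<alpha> *\<^sub>R x + sqrt (1 - \<alpha>) *\<^sub>R y"
      have "(norm z)\<^sup>2 = (norm (sqrt \<alpha> *\<^sub>R x))\<^sup>2 + (norm (sqrt (1 - \<alpha>) *\<^sub>R y))\<^sup>2"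
        unfolding z_def using o by (intro norm_add_sq_orthogonal) (simp add: qinner_scaleR_left qinner_scaleR_right)
      then have "(norm z)\<^sup>2 = 1" using \<alpha> x y by simp
      then have "norm z = 1" by (metis norm_ge_zero one_power2 power2_eq_imp_eq zero_le_one)
      moreover have "z \<in> qperp F" using o y by (simp add: z_def qperp_add qperp_scaleR)
      moreover have "qinner (T z) z = \<alpha> *\<^sub>R w + (1 - \<alpha>) *\<^sub>R v"
        using \<alpha> o by (simp add: z_def bounded_opsD[OF T] qinner_add_left qinner_add_right
            qinner_scaleR_left qinner_scaleR_right x y)
      ultimately show "\<alpha> *\<^sub>R w + (1 - \<alpha>) *\<^sub>R v \<in> tail_range T F"
        unfolding tail_range_def by (auto intro!: exI[of _ z])
    qed
    then have "(\<lambda>w. \<alpha> *\<^sub>R w + (1 - \<alpha>) *\<^sub>R v) ` closure (tail_range T (F \<union> {y, T y, t})) \<subseteq> closure (tail_range T F)"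
      by (intro image_closure_subset continuous_intros) (auto intro: closure_subset[THEN subsetD])
    with e' show ?thesis by blast
  qed
  then have "(\<lambda>v. \<alpha> *\<^sub>R e + (1 - \<alpha>) *\<^sub>R v) ` closure (tail_range T F) \<subseteq> closure (tail_range T F)"
    by (intro image_closure_subset continuous_intros) auto
  with v show ?thesis by blast
qed

text \<open>
A point of \<open>limit_range T\<close> is in the closure of every tail range, so the second point of
the combination can be taken there too.
\<close>

lemma convex_limit_range:
  assumes "T \<in> bounded_ops" "d \<in> limit_range T" "e \<in> limit_range T" "0 \<le> \<alpha>" "\<alpha> \<le> 1"
  shows "\<alpha> *\<^sub>R d + (1 - \<alpha>) *\<^sub>R e \<in> limit_range T"
  using limit_range_combination[OF assms(1) _ assms(2) _ assms(4,5)] assms(3)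
  by (simp add: limit_range_def)

text \<open>
Replacing a unit vector \<open>x\<close> by \<open>xu\<close> conjugates the value of the form by \<open>u\<close> and preserves
orthogonality.
\<close>

lemma limit_range_conjugate:
  assumes T: "T \<in> bounded_ops" and e: "e \<in> limit_range T" and u: "norm u = 1"
  shows "qcnj u * e * u \<in> limit_range T"
proof -
  have "qcnj u * e * u \<in> closure (tail_range T F)" if "finite F" for F
  proof -
    have "qcnj u * w * u \<in> tail_range T F" if "w \<in> tail_range T F" for w
    proof -
      obtain x where "w = qinner (T x) x" "norm x = 1" "x \<in> qperp F"
        using \<open>w \<in> tail_range T F\<close> by (auto simp: tail_range_def)
      then show ?thesis unfolding tail_range_def
        by (auto intro!: exI[of _ "x *\<^sub>H u"] simp: bounded_opsD(2)[OF T] norm_rscale u qinner_rscale qperp_rscale)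
    qed
    then have "(\<lambda>w. qcnj u * w * u) ` closure (tail_range T F) \<subseteq> closure (tail_range T F)"
      by (intro image_closure_subset continuous_intros) (auto intro: closure_subset[THEN subsetD])
    with e that show ?thesis by (auto simp: limit_range_def)
  qed
  then show ?thesis by (simp add: limit_range_def)
qed

text \<open>
Real values are the ones for which a scalar operator has a single value as its numerical range; they
serve as the filler on finite dimensional subspaces in \<open>essential_subset_limit_range\<close>.
\<close>

lemma real_in_limit_range:
  assumes inf: "infinite_dimensional TYPE('a::quat_hilbert)" and T: "(T :: 'a \<Rightarrow> 'a) \<in> bounded_ops"
  obtains r where "of_real r \<in> limit_range T"
proof -
  obtain e where e: "e \<in> limit_range T" using limit_range_nonempty[OF assms] by blast
  have mid: "(1/2) *\<^sub>R c + (1/2) *\<^sub>R d \<in> limit_range T" if "c \<in> limit_range T" "d \<in> limit_range T" for c d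
    using convex_limit_range[OF T that, of "1/2"] by simp
  have "of_real (qRe e) \<in> limit_range T"
    unfolding average_of_conjugates[of e, symmetric]
    by (intro mid limit_range_conjugate[OF T e] ) (simp_all add: norm_quat_def inner_quat_def)
  then show thesis by (rule that)
qed

text \<open>
A finite \<open>\<epsilon>/2\<close>-net \<open>F\<close> of the image of the unit ball under \<open>K\<close> gives \<open>\<bar>\<langle>Kx, x\<rangle>\<bar> < \<epsilon>/2\<close> for every unit
vector \<open>x\<close> orthogonal to \<open>F\<close>.
\<close>

lemma limit_range_subset_essential:
  assumes T: "T \<in> bounded_ops"
  shows "limit_range T \<subseteq> essential_numerical_range T"
proof
  fix a assume a: "a \<in> limit_range T"
  have "a \<in> closure (numerical_range (\<lambda>x. T x + K x))" if K: "K \<in> compact_ops" for K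
    unfolding closure_approachable
  proof (intro allI impI)
    fix \<epsilon> :: real assume \<epsilon>: "\<epsilon> > 0"
    obtain C where C: "compact C" "\<And>x. norm x \<le> 1 \<Longrightarrow> K x \<in> C" using K by (rule compact_opsE) blast
    obtain F where F: "finite F" "C \<subseteq> (\<Union>k\<in>F. ball k (\<epsilon>/2))"
      using C(1) half_gt_zero[OF \<epsilon>] unfolding compact_eq_totally_bounded by blast
    then have "a \<in> closure (tail_range T F)" using a by (auto simp: limit_range_def)
    then obtain b where "b \<in> tail_range T F" "dist b a < \<epsilon>/2"
      using half_gt_zero[OF \<epsilon>] unfolding closure_approachable by blast
    then obtain x where x: "norm x = 1" "x \<in> qperp F" "dist (qinner (T x) x) a < \<epsilon>/2"
      unfolding tail_range_def by blast
    have "K x \<in> C" using x(1) C(2) by simp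
    then obtain k where k: "k \<in> F" "dist k (K x) < \<epsilon>/2" using F(2) by auto
    have "qinner (K x) x = qinner (K x - k) x" using qperpD(2)[OF x(2) k(1)] by (simp add: qinner_diff_left)
    then have "norm (qinner (K x) x) < \<epsilon>/2"
      using qinner_Cauchy_Schwarz[of "K x - k" x] k(2) x(1) by (simp add: dist_norm norm_minus_commute)
    then have "dist (qinner (T x + K x) x) a < \<epsilon>"
      using x(3) norm_triangle_ineq[of "qinner (T x) x - a" "qinner (K x) x"]
      by (simp add: dist_norm qinner_add_left algebra_simps)
    then show "\<exists>y\<in>numerical_range (\<lambda>x. T x + K x). dist y a < \<epsilon>"
      using x(1) unfolding numerical_range_def by blast
  qed
  then show "a \<in> essential_numerical_range T" by (simp add: essential_numerical_range_def)
qed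

text \<open>
With \<open>P\<close> the projection onto the span of an orthonormal set \<open>B\<close> whose complement lies in that of \<open>F\<close>,
and \<open>r\<close> a real point of \<open>limit_range T\<close>, the compact operator is
\<open>K = rP + (1-P)T(1-P) - T\<close>.  The numerical range of \<open>T + K\<close> is contained in the closure of
\<open>tail_range T F\<close>.
\<close>

lemma essential_subset_limit_range:
  assumes inf: "infinite_dimensional TYPE('a::quat_hilbert)" and T: "(T :: 'a \<Rightarrow> 'a) \<in> bounded_ops"
  shows "essential_numerical_range T \<subseteq> limit_range T"
proof
  fix a assume a: "a \<in> essential_numerical_range T"
  obtain r where r: "of_real r \<in> limit_range T" using real_in_limit_range[OF assms] .
  have "a \<in> closure (tail_range T F)" if "finite F" for F
  proof -
    obtain B where B: "finite B" "qorthonormal B" "qperp B \<subseteq> qperp F"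
      using finite_set_orthonormalise[OF \<open>finite F\<close>] by blast
    have "qproj B \<in> compact_ops"
      unfolding qproj_def[abs_def] by (rule compact_ops_sum) (rule rank_one_compact[OF bounded_ops_id])
    then have P: "qproj B \<in> bounded_ops" by (simp add: compact_ops_def)
    (* The finite rank operator (rP - TP) + P(TP - T), arranged as a sum of rank one operators. *)
    define K where "K x = (\<Sum>b\<in>B. (r *\<^sub>R b - T b) *\<^sub>H qinner x b)
        + (\<Sum>b\<in>B. b *\<^sub>H qinner (T (qproj B x) - T x) b)" for x
    have "K \<in> compact_ops"
      unfolding K_def[abs_def]
    proof (rule compact_ops_add)
      show "(\<lambda>x. \<Sum>b\<in>B. (r *\<^sub>R b - T b) *\<^sub>H qinner x b) \<in> compact_ops"
        by (rule compact_ops_sum) (rule rank_one_compact[OF bounded_ops_id])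
      show "(\<lambda>x. \<Sum>b\<in>B. b *\<^sub>H qinner (T (qproj B x) - T x) b) \<in> compact_ops"
        by (rule compact_ops_sum) (rule rank_one_compact[OF bounded_ops_diff[OF bounded_ops_compose[OF T P] T]])
    qed
    with a have a': "a \<in> closure (numerical_range (\<lambda>x. T x + K x))"
      by (auto simp: essential_numerical_range_def)
    have K: "T x + K x = r *\<^sub>R qproj B x + (T (x - qproj B x) - qproj B (T (x - qproj B x)))" for x
    proof -
      have "(\<Sum>b\<in>B. (r *\<^sub>R b - T b) *\<^sub>H qinner x b) = r *\<^sub>R qproj B x - T (qproj B x)"
        unfolding qproj_def by (simp add: bounded_opsD[OF T] rscale_diff_left sum_subtractf scaleR_sum_right
            rscale_scaleR_left)
      then show ?thesis unfolding K_def qproj_def[of B "T (qproj B x) - T x", symmetric]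
        by (simp add: bounded_opsD[OF T] bounded_opsD[OF P])
    qed
    have "numerical_range (\<lambda>x. T x + K x) \<subseteq> closure (tail_range T F)"
    proof
      fix w assume "w \<in> numerical_range (\<lambda>x. T x + K x)"
      then obtain x where x: "w = qinner (T x + K x) x" "norm x = 1" by (auto simp: numerical_range_def)
      define p z where "p = qproj B x" and "z = x - p"
      have xpz: "x = p + z" by (simp add: z_def)
      have z: "z \<in> qperp B" unfolding z_def p_def using B by (intro minus_qproj_perp)
      have Tz: "T z - qproj B (T z) \<in> qperp B" using B by (intro minus_qproj_perp)
      have sq: "(norm p)\<^sup>2 + (norm z)\<^sup>2 = 1"
        using norm_sq_qproj[OF B(1,2), of x] x(2) by (simp add: p_def z_def)
      have "w = qinner (r *\<^sub>R p + (T z - qproj B (T z))) (p + z)"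
        unfolding x(1) K p_def[symmetric] z_def[symmetric] by (simp add: xpz[symmetric])
      also have "\<dots> = (norm p)\<^sup>2 *\<^sub>R of_real r + qinner (T z) z"
      proof -
        have "qinner p z = 0" "qinner (T z - qproj B (T z)) p = 0" "qinner (qproj B (T z)) z = 0"
          unfolding p_def by (intro qinner_qproj_perp z Tz)+
        moreover have "r *\<^sub>R qinner p p = (norm p)\<^sup>2 *\<^sub>R of_real r"
          by (simp add: qinner_self quat_eq_iff del: of_real_power)
        ultimately show ?thesis
          by (simp add: qinner_add_left qinner_add_right qinner_scaleR_left
              qinner_diff_left[of "T z" _ z])
      qed
      finally have w: "w = (norm p)\<^sup>2 *\<^sub>R of_real r + qinner (T z) z" .
      show "w \<in> closure (tail_range T F)"
      proof (cases "z = 0")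
        case True
        then have "w = of_real r" using w sq by (simp add: bounded_opsD[OF T])
        then show ?thesis using r \<open>finite F\<close> by (simp add: limit_range_def)
      next
        case False
        define v where "v = inverse ((norm z)\<^sup>2) *\<^sub>R qinner (T z) z"
        have "z \<in> qperp F" using z B(3) by blast
        then have "v \<in> closure (tail_range T F)"
          using normalised_in_tail_range[OF T _ False] closure_subset unfolding v_def by blast
        moreover have "1 - (norm p)\<^sup>2 = (norm z)\<^sup>2" using sq by linarith
        then have "qinner (T z) z = (1 - (norm p)\<^sup>2) *\<^sub>R v"
          using False by (simp add: v_def)
        ultimately show ?thesis
          using limit_range_combination[OF T \<open>finite F\<close> r, of v "(norm p)\<^sup>2"] w sq
            zero_le_power2[of "norm z"] by simp
      qed
    qed
    then have "closure (numerical_range (\<lambda>x. T x + K x)) \<subseteq> closure (tail_range T F)"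
      by (simp add: closure_minimal)
    with a' show ?thesis by blast
  qed
  then show "a \<in> limit_range T" by (simp add: limit_range_def)
qed

section \<open>Weak cluster points\<close>

text \<open>
Weak compactness of the unit ball: the functionals \<open>\<langle>\<cdot>, X n\<rangle>\<close> lie in a product of balls, which is
compact by Tychonoff's theorem.  A cluster point \<open>\<phi>\<close> of them is right linear, since these
identities are closed conditions on evaluations, and is represented by a vector.
\<close>

lemma weak_cluster_point:
  fixes X :: "nat \<Rightarrow> 'a::quat_hilbert"
  assumes X: "\<And>n. norm (X n) \<le> 1"
  obtains x where "norm x \<le> 1"
    and "\<And>Y \<epsilon> N. finite Y \<Longrightarrow> \<epsilon> > 0 \<Longrightarrow> \<exists>n\<ge>N. \<forall>y\<in>Y. dist (qinner y (X n)) (qinner y x) < \<epsilon>"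
proof -
  define g where "g n = (\<lambda>y. qinner y (X n))" for n
  define S where "S = (PiE UNIV (\<lambda>y. cball 0 (norm y)) :: ('a \<Rightarrow> quat) set)"
  have "compactin (product_topology (\<lambda>_. euclidean) UNIV) S"
    unfolding S_def compactin_PiE by simp
  then have S: "compact S" by (simp add: euclidean_product_topology)
  have gS: "g n \<in> S" for n
  proof -
    have "norm (qinner y (X n)) \<le> norm y" for y
      using qinner_Cauchy_Schwarz[of y "X n"] mult_left_le[OF X[of n] norm_ge_zero[of y]] by linarith
    then show ?thesis by (simp add: S_def g_def PiE_iff)
  qed
  have "S \<inter> (\<Inter>N\<in>UNIV. closure (g ` {N..})) \<noteq> {}"
  proof (rule compact_imp_fip_image[OF S])
    fix I :: "nat set" assume I: "finite I" "I \<subseteq> UNIV"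
    then obtain m where m: "\<And>N. N \<in> I \<Longrightarrow> N \<le> m" using finite_nat_set_iff_bounded_le by auto
    have "g m \<in> closure (g ` {N..})" if "N \<in> I" for N
      using m[OF that] by (intro subsetD[OF closure_subset] imageI) simp
    then show "S \<inter> (\<Inter>N\<in>I. closure (g ` {N..})) \<noteq> {}" using gS[of m] by blast
  qed simp
  then obtain \<phi> where \<phi>S: "\<phi> \<in> S" and \<phi>: "\<And>N. \<phi> \<in> closure (g ` {N..})" by blast
  have ev: "continuous_on UNIV (\<lambda>\<psi> :: 'a \<Rightarrow> quat. \<psi> y)" for y
    by (rule continuous_on_product_coordinates)
  have closed_mem: "\<phi> \<in> C" if "closed C" "range g \<subseteq> C" for C
  proof -
    have "closure (g ` {0..}) \<subseteq> C" using that by (intro closure_minimal) auto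
    then show ?thesis using \<phi> by blast
  qed
  have "\<phi> \<in> {\<psi>. \<psi> (y + z) = \<psi> y + \<psi> z}" for y z
  proof (rule closed_mem)
    show "closed {\<psi> :: 'a \<Rightarrow> quat. \<psi> (y + z) = \<psi> y + \<psi> z}"
      by (intro closed_Collect_eq ev continuous_on_add)
  qed (auto simp: g_def qinner_add_left)
  then have add: "\<phi> (y + z) = \<phi> y + \<phi> z" for y z by simp
  have "\<phi> \<in> {\<psi>. \<psi> (y *\<^sub>H q) = \<psi> y * q}" for y q
  proof (rule closed_mem)
    show "closed {\<psi> :: 'a \<Rightarrow> quat. \<psi> (y *\<^sub>H q) = \<psi> y * q}"
      by (intro closed_Collect_eq ev continuous_on_mult continuous_on_const)
  qed (auto simp: g_def qinner_rscale_left)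
  then have hom: "\<phi> (y *\<^sub>H q) = \<phi> y * q" for y q by simp
  have bound: "norm (\<phi> y) \<le> 1 * norm y" for y
    using \<phi>S by (simp add: S_def PiE_iff)
  obtain x where x: "\<And>y. \<phi> y = qinner y x"
    using Riesz_representation[OF add hom bound] by blast
  have "(norm x)\<^sup>2 \<le> norm x"
    using bound[of x] by (simp add: x qinner_self del: of_real_power)
  then have "norm x \<le> 1"
    by (cases "norm x = 0") (simp_all add: power2_eq_square mult_le_cancel_left1)
  moreover have "\<exists>n\<ge>N. \<forall>y\<in>Y. dist (qinner y (X n)) (qinner y x) < \<epsilon>" if Y: "finite Y" "\<epsilon> > 0" for Y \<epsilon> N
  proof -
    define U where "U = (\<Inter>y\<in>Y. (\<lambda>\<psi> :: 'a \<Rightarrow> quat. \<psi> y) -` ball (qinner y x) \<epsilon>)"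
    have "open U"
      unfolding U_def using Y(1) by (intro open_INT ballI open_vimage ev) auto
    moreover have "\<phi> \<in> U" using Y(2) by (simp add: U_def x)
    ultimately have "U \<inter> g ` {N..} \<noteq> {}"
      using \<phi>[of N] open_Int_closure_eq_empty[of U "g ` {N..}"] by blast
    then obtain n where "n \<ge> N" "g n \<in> U" by blast
    then show ?thesis by (auto simp: U_def g_def dist_commute)
  qed
  ultimately show thesis by (rule that)
qed

text \<open>
Vectors that become orthogonal to a finite set only in the limit are projected to its
complement.  The correction \<open>p\<close> tends to zero in norm, so neither the limit of the squared norms nor that
of the form changes, and division by the squared norm gives points of the tail range.
\<close>

lemma weakly_null_in_limit_range:
  fixes T :: "'a::quat_hilbert \<Rightarrow> 'a"
  assumes T: "T \<in> bounded_ops" and c: "c > 0"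
    and seq: "\<And>F. finite F \<Longrightarrow> \<exists>d. (\<forall>y\<in>F. (\<lambda>k. qinner (d k) y) \<longlonglongrightarrow> 0)
      \<and> (\<lambda>k. (norm (d k))\<^sup>2) \<longlonglongrightarrow> c \<and> (\<lambda>k. qinner (T (d k)) (d k)) \<longlonglongrightarrow> w"
  shows "inverse c *\<^sub>R w \<in> limit_range T"
proof -
  have "inverse c *\<^sub>R w \<in> closure (tail_range T F)" if "finite F" for F
  proof -
    obtain B where B: "finite B" "qorthonormal B" "qperp B \<subseteq> qperp F"
      using finite_set_orthonormalise[OF \<open>finite F\<close>] by blast
    obtain d where d: "\<And>y. y \<in> B \<Longrightarrow> (\<lambda>k. qinner (d k) y) \<longlonglongrightarrow> 0"
      "(\<lambda>k. (norm (d k))\<^sup>2) \<longlonglongrightarrow> c" "(\<lambda>k. qinner (T (d k)) (d k)) \<longlonglongrightarrow> w"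
      using seq[OF B(1)] by blast
    define p z where "p k = qproj B (d k)" and "z k = d k - p k" for k
    have z: "z k \<in> qperp F" for k
      using minus_qproj_perp[OF B(1,2), of "d k"] B(3) by (auto simp: z_def p_def)
    have "(\<lambda>k. \<Sum>b\<in>B. b *\<^sub>H qinner (d k) b) \<longlonglongrightarrow> (\<Sum>b\<in>B. b *\<^sub>H 0)"
      by (intro tendsto_sum bounded_linear.tendsto[OF bounded_linear_rscale] d)
    then have p: "p \<longlonglongrightarrow> 0" by (simp add: p_def[abs_def] qproj_def)
    have Tp: "(\<lambda>k. T (p k)) \<longlonglongrightarrow> 0"
      using bounded_linear.tendsto[OF bounded_opsD(1)[OF T] p] by (simp add: bounded_opsD(6)[OF T])
    have nd: "(\<lambda>k. norm (d k)) \<longlonglongrightarrow> sqrt c"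
      using tendsto_real_sqrt[OF d(2)] by simp
    have "(\<lambda>k. (norm (d k))\<^sup>2 - (norm (p k))\<^sup>2) \<longlonglongrightarrow> c - (norm (0 :: 'a))\<^sup>2"
      by (rule tendsto_diff[OF d(2) tendsto_power[OF tendsto_norm[OF p]]])
    moreover have "(norm (z k))\<^sup>2 = (norm (d k))\<^sup>2 - (norm (p k))\<^sup>2" for k
      using norm_sq_qproj[OF B(1,2), of "d k"] unfolding z_def p_def by linarith
    ultimately have nz: "(\<lambda>k. (norm (z k))\<^sup>2) \<longlonglongrightarrow> c" by simp
    have small: "(\<lambda>k. qinner (u k) (v k)) \<longlonglongrightarrow> 0"
      if "(\<lambda>k. norm (u k) * norm (v k)) \<longlonglongrightarrow> 0" for u v :: "nat \<Rightarrow> 'a"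
      by (rule Lim_null_comparison[OF _ that]) (simp add: qinner_Cauchy_Schwarz)
    have np: "(\<lambda>k. norm (p k)) \<longlonglongrightarrow> 0" and nTp: "(\<lambda>k. norm (T (p k))) \<longlonglongrightarrow> 0"
      using p Tp by (simp_all add: tendsto_norm_zero)
    have "(\<lambda>k. norm (T (d k)) * norm (p k)) \<longlonglongrightarrow> 0"
    proof (rule Lim_null_comparison)
      show "(\<lambda>k. onorm T * norm (d k) * norm (p k)) \<longlonglongrightarrow> 0"
        using tendsto_mult[OF tendsto_mult[OF tendsto_const[of "onorm T"] nd] np] by simp
      show "\<forall>\<^sub>F k in sequentially. norm (norm (T (d k)) * norm (p k)) \<le> onorm T * norm (d k) * norm (p k)"
        using mult_right_mono[OF onorm[OF bounded_opsD(1)[OF T]] norm_ge_zero]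
        by (intro always_eventually allI) (simp only: real_norm_def abs_mult abs_norm_cancel)
    qed
    then have 1: "(\<lambda>k. qinner (T (d k)) (p k)) \<longlonglongrightarrow> 0" by (rule small)
    have nz': "(\<lambda>k. norm (z k)) \<longlonglongrightarrow> sqrt c"
      using tendsto_real_sqrt[OF nz] by simp
    have 2: "(\<lambda>k. qinner (T (p k)) (z k)) \<longlonglongrightarrow> 0"
      using tendsto_mult[OF nTp nz'] by (intro small) simp
    have "qinner (T (z k)) (z k) = qinner (T (d k)) (d k) - qinner (T (d k)) (p k) - qinner (T (p k)) (z k)" for k
      by (simp add: z_def bounded_opsD[OF T] qinner_diff_left qinner_diff_right)
    then have "(\<lambda>k. qinner (T (z k)) (z k)) \<longlonglongrightarrow> w"
      using tendsto_diff[OF tendsto_diff[OF d(3) 1] 2] by simp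
    then have lim: "(\<lambda>k. inverse ((norm (z k))\<^sup>2) *\<^sub>R qinner (T (z k)) (z k)) \<longlonglongrightarrow> inverse c *\<^sub>R w"
      using c nz by (intro tendsto_intros) auto
    have "\<forall>\<^sub>F k in sequentially. 0 < (norm (z k))\<^sup>2"
      using order_tendstoD(1)[OF nz c] .
    then have "\<forall>\<^sub>F k in sequentially. inverse ((norm (z k))\<^sup>2) *\<^sub>R qinner (T (z k)) (z k) \<in> closure (tail_range T F)"
    proof eventually_elim
      case (elim k)
      then have "z k \<noteq> 0" by auto
      then show ?case
        by (intro subsetD[OF closure_subset] normalised_in_tail_range[OF T z])
    qed
    then show ?thesis
      by (rule Lim_in_closed_set[OF closed_closure _ sequentially_bot lim])
  qed
  then show ?thesis by (simp add: limit_range_def)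
qed

lemma iconvI:
  "a \<in> A \<Longrightarrow> b \<in> B \<Longrightarrow> 0 \<le> \<alpha> \<Longrightarrow> \<alpha> \<le> 1 \<Longrightarrow> \<alpha> *\<^sub>R a + (1 - \<alpha>) *\<^sub>R b \<in> iconv A B"
  unfolding iconv_def by blast

text \<open>
Let unit vectors \<open>X n\<close> have values tending to \<open>a\<close>, and let \<open>x\<close> be a weak cluster point.  The
differences \<open>X n - x\<close> carry the mass \<open>c = 1 - \<parallel>x\<parallel>\<^sup>2\<close> and the form value \<open>a - \<langle>Tx, x\<rangle>\<close> in the limit.  If
\<open>c = 0\<close> they tend to zero in norm and \<open>a\<close> is attained at \<open>x\<close>; otherwise they yield the
point of \<open>limit_range T\<close> that enters with weight \<open>c\<close>.
\<close>

lemma closure_numerical_range_subset: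
  fixes T :: "'a::quat_hilbert \<Rightarrow> 'a"
  assumes inf: "infinite_dimensional TYPE('a)" and T: "T \<in> bounded_ops"
  shows "closure (numerical_range T) \<subseteq> iconv (limit_range T) (numerical_range T)"
proof
  fix a assume "a \<in> closure (numerical_range T)"
  then obtain w where w: "\<And>n. w n \<in> numerical_range T" "w \<longlonglongrightarrow> a"
    unfolding closure_sequential by blast
  then have "\<exists>x. w n = qinner (T x) x \<and> norm x = 1" for n
    by (auto simp: numerical_range_def)
  then obtain X where X: "\<And>n. w n = qinner (T (X n)) (X n)" "\<And>n. norm (X n) = 1" by metis
  obtain x where x: "norm x \<le> 1"
    "\<And>Y \<epsilon> N. finite Y \<Longrightarrow> \<epsilon> > 0 \<Longrightarrow> \<exists>n\<ge>N. \<forall>y\<in>Y. dist (qinner y (X n)) (qinner y x) < \<epsilon>"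
    by (rule weak_cluster_point[of X]) (simp_all add: X(2))
  define c where "c = 1 - (norm x)\<^sup>2"
  obtain t where t: "\<And>z. qinner (T z) x = qinner z t" using adjoint_vector[OF T] by blast
  have seq: "\<exists>d. (\<forall>y\<in>F. (\<lambda>k. qinner (d k) y) \<longlonglongrightarrow> 0)
      \<and> (\<lambda>k. (norm (d k))\<^sup>2) \<longlonglongrightarrow> c \<and> (\<lambda>k. qinner (T (d k)) (d k)) \<longlonglongrightarrow> a - qinner (T x) x"
    if "finite F" for F
  proof -
    (* Besides F, the vectors x, Tx and t = T*x control the cross terms. *)
    define Y where "Y = F \<union> {x, T x, t}"
    have "finite Y" using that by (simp add: Y_def)
    then have "\<forall>k. \<exists>n\<ge>k. \<forall>y\<in>Y. dist (qinner y (X n)) (qinner y x) < inverse (real (Suc k))"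
      using x(2) by simp
    then obtain n where n: "\<And>k. n k \<ge> k"
      "\<And>k y. y \<in> Y \<Longrightarrow> dist (qinner y (X (n k))) (qinner y x) < inverse (real (Suc k))"
      by metis
    define d where "d k = X (n k) - x" for k
    have R: "(\<lambda>k. qinner y (d k)) \<longlonglongrightarrow> 0" if "y \<in> Y" for y
    proof (rule Lim_null_comparison[OF _ LIMSEQ_inverse_real_of_nat])
      show "\<forall>\<^sub>F k in sequentially. norm (qinner y (d k)) \<le> inverse (real (Suc k))"
        using n(2)[OF that] by (auto simp: d_def qinner_diff_right dist_norm intro!: always_eventually less_imp_le simp del: of_nat_Suc)
    qed
    have L: "(\<lambda>k. qinner (d k) y) \<longlonglongrightarrow> 0" if "y \<in> Y" for y
    proof (rule tendsto_norm_zero_cancel)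
      have "norm (qinner (d k) y) = norm (qinner y (d k))" for k
        by (metis qinner_commute norm_qcnj)
      then show "(\<lambda>k. norm (qinner (d k) y)) \<longlonglongrightarrow> 0"
        using tendsto_norm_zero[OF R[OF that]] by simp
    qed
    have Xd: "X (n k) = x + d k" for k by (simp add: d_def)
    have "(norm (d k))\<^sup>2 = c - 2 * qRe (qinner x (d k))" for k
      using X(2)[of "n k"] norm_add_sq[of x "d k"] by (simp add: Xd c_def)
    moreover have "(\<lambda>k. c - 2 * qRe (qinner x (d k))) \<longlonglongrightarrow> c - 2 * qRe 0"
      by (intro tendsto_intros bounded_linear.tendsto[OF bounded_linear_qRe] R) (simp add: Y_def)
    ultimately have norm: "(\<lambda>k. (norm (d k))\<^sup>2) \<longlonglongrightarrow> c" by simp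
    have "filterlim n at_top sequentially"
      by (rule filterlim_at_top_mono[OF filterlim_ident]) (simp add: n)
    then have "(\<lambda>k. w (n k)) \<longlonglongrightarrow> a" by (rule filterlim_compose[OF w(2)])
    then have "(\<lambda>k. w (n k) - qinner (T x) x - qinner (T x) (d k) - qinner (d k) t) \<longlonglongrightarrow> a - qinner (T x) x - 0 - 0"
      by (intro tendsto_diff R L tendsto_const) (simp_all add: Y_def)
    moreover have "qinner (T (d k)) (d k) = w (n k) - qinner (T x) x - qinner (T x) (d k) - qinner (d k) t" for k
      by (simp add: X(1) Xd bounded_opsD[OF T] qinner_add_left qinner_add_right t[symmetric])
    ultimately have "(\<lambda>k. qinner (T (d k)) (d k)) \<longlonglongrightarrow> a - qinner (T x) x" by simp
    with L norm show ?thesis by (intro exI[of _ d]) (simp add: Y_def)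
  qed
  have "c \<ge> 0" using x(1) by (simp add: c_def power_le_one)
  show "a \<in> iconv (limit_range T) (numerical_range T)"
  proof (cases "c = 0")
    case True
    obtain d where d: "(\<lambda>k. (norm (d k))\<^sup>2) \<longlonglongrightarrow> 0" "(\<lambda>k. qinner (T (d k)) (d k)) \<longlonglongrightarrow> a - qinner (T x) x"
      using seq[of "{}"] True by auto
    have "(\<lambda>k. norm (d k)) \<longlonglongrightarrow> 0" using tendsto_real_sqrt[OF d(1)] by simp
    then have d0: "d \<longlonglongrightarrow> 0" by (rule tendsto_norm_zero_cancel)
    have "(\<lambda>k. qinner (T (d k)) (d k)) \<longlonglongrightarrow> qinner (T 0) 0"
      by (intro bounded_bilinear.tendsto[OF bounded_bilinear_qinner] bounded_linear.tendsto[OF bounded_opsD(1)[OF T]] d0)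
    from LIMSEQ_unique[OF this d(2)] have "a = qinner (T x) x" by simp
    moreover have "norm x = 1"
      using True by (simp add: c_def) (metis norm_ge_zero one_power2 power2_eq_imp_eq zero_le_one)
    ultimately have "a \<in> numerical_range T" by (auto simp: numerical_range_def)
    moreover obtain e where "e \<in> limit_range T" using limit_range_nonempty[OF inf T] by blast
    ultimately show ?thesis
      using iconvI[of e "limit_range T" a "numerical_range T" 0] by simp
  next
    case False
    with \<open>c \<ge> 0\<close> have c: "c > 0" by simp
    have e: "inverse c *\<^sub>R (a - qinner (T x) x) \<in> limit_range T"
      by (rule weakly_null_in_limit_range[OF T c seq])
    obtain b where b: "b \<in> numerical_range T" "qinner (T x) x = (1 - c) *\<^sub>R b"
    proof (cases "x = 0")
      (* Here b has weight 0, so any value will do. *)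
      case True
      then show thesis using that[OF w(1)[of 0]] by (simp add: c_def bounded_opsD[OF T])
    next
      case False
      have "x \<in> qperp {}" by (simp add: qperp_def)
      from normalised_in_tail_range[OF T this False]
      show thesis using False by (intro that) (auto simp: tail_range_empty c_def)
    qed
    have "a = c *\<^sub>R (inverse c *\<^sub>R (a - qinner (T x) x)) + (1 - c) *\<^sub>R b"
      using c by (simp flip: b(2))
    moreover have "c \<le> 1" by (simp add: c_def)
    ultimately show ?thesis
      using iconvI[OF e b(1) \<open>c \<ge> 0\<close>] by simp
  qed
qed

theorem theorem3p3:
  fixes T :: "'a::quat_hilbert \<Rightarrow> 'a"
  assumes "infinite_dimensional TYPE('a)"
    and "T \<in> bounded_ops"
  shows "closure (numerical_range T) = iconv (essential_numerical_range T) (numerical_range T)"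
proof -
  have W: "essential_numerical_range T = limit_range T"
    using essential_subset_limit_range[OF assms] limit_range_subset_essential[OF assms(2)] by blast
  have "iconv (limit_range T) (numerical_range T) \<subseteq> closure (numerical_range T)"
  proof
    fix a assume "a \<in> iconv (limit_range T) (numerical_range T)"
    then obtain \<alpha> e v where a: "a = \<alpha> *\<^sub>R e + (1 - \<alpha>) *\<^sub>R v" "e \<in> limit_range T" "v \<in> numerical_range T"
      "0 \<le> \<alpha>" "\<alpha> \<le> 1"
      unfolding iconv_def by blast
    then have "v \<in> closure (tail_range T {})" unfolding tail_range_empty using closure_subset by blast
    then show "a \<in> closure (numerical_range T)"
      using limit_range_combination[OF assms(2) finite.emptyI a(2) _ a(4,5)] by (simp add: a(1) tail_range_empty)
  qed
  with closure_numerical_range_subset[OF assms] show ?thesis unfolding W by (rule antisym)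
qed

end
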